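(* Let $E$ be an $n$-dimensional evolution algebra over a field $K$ with natural basis $\{e_1,\dots,e_n\}$ and strictly upper triangular matrix of structural constants $A=(a_{ij})_{i,j=1}^n$ (i.e. $a_{ij}=0$ for $i\ge j$). Suppose that for some integer $s$ with $1\le s<n-1$ and some indices $1\le i_1<i_2<\dots<i_{s-1}\le n-2$, with $i_s:=n$, the following hold: (i) $a_{j i_k}=a_{i_k j}=0$ for all $j\notin\{i_1,\dots,i_{s-1},n\}$ and all $k=1,\dots,s-1$; (ii) $a_{i_k i_{k+1}}=1$ for all $k=1,\dots,s-1$; (iii) if $j_1<j_2<\dots<j_{n-s+1}=n$ are the elements of $\{1,\dots,n\}\setminus\{i_1,\dots,i_{s-1}\}$ in increasing order, then $a_{j_l j_{l+1}}=1$ for all $l=1,\dots,n-s$. Then the nilpotent index of $E$ is equal to $2^{\max\{s-1,\,n-s\}}+1$.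
   Context: An algebra $E$ over a field $K$ is an evolution algebra if it admits a basis $\{e_1,e_2,\dots\}$ (called a natural basis) such that $e_ie_j=0$ for $i\ne j$ and $e_ie_i=\sum_k a_{ik}e_k$; the matrix $A=(a_{ij})$ is the matrix of structural constants of $E$ in this basis. Put $E^1=E$ and $E^k=\sum_{i=1}^{k-1}E^iE^{k-i}$ for $k\ge 2$, where the product of two subspaces is the linear span of all products. The nilpotent index (index of nilpotency) of $E$ is the smallest $k$ with $E^k=0$. *)

theory Defs
  imports Complex_Main
begin

text \<open>Algebras over a field, carried by a whole type; associativity, commutativity and a unit
  are not assumed.\<close>

locale nonassoc_algebra = vector_space scale
  for scale :: "'k::field \<Rightarrow> 'e::ab_group_add \<Rightarrow> 'e" (infixr \<open>*s\<close> 75) +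
  fixes mult :: "'e \<Rightarrow> 'e \<Rightarrow> 'e" (infixl \<open>\<bullet>\<close> 70)
  assumes linear_mult_right: "Vector_Spaces.linear scale scale (\<lambda>y. x \<bullet> y)"
    and linear_mult_left: "Vector_Spaces.linear scale scale (\<lambda>x. x \<bullet> y)"
begin

definition subspace_prod :: "'e set \<Rightarrow> 'e set \<Rightarrow> 'e set" where
  "subspace_prod U V = span {u \<bullet> v | u v. u \<in> U \<and> v \<in> V}"

text \<open>The sum of the subspaces \<open>E\<^sup>i E\<^sup>k\<^sup>-\<^sup>i\<close> is rendered as the span of their union. The value
  at \<open>k = 0\<close> is a dummy: no exponent in the recursion and none in \<open>is_nilpotent_index\<close> is \<open>0\<close>.\<close>

fun alg_power :: "nat \<Rightarrow> 'e set" where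
  "alg_power k =
    (if k \<le> 1 then UNIV
     else span (\<Union>i\<in>{1..<k}. subspace_prod (alg_power i) (alg_power (k - i))))"

declare alg_power.simps [simp del]

text \<open>A relation rather than a \<open>LEAST\<close> term, so that it fails for every \<open>k\<close> when the algebra is
  not nilpotent.\<close>

definition is_nilpotent_index :: "nat \<Rightarrow> bool" where
  "is_nilpotent_index k \<longleftrightarrow>
    1 \<le> k \<and> alg_power k = {0} \<and> (\<forall>m. 1 \<le> m \<and> m < k \<longrightarrow> alg_power m \<noteq> {0})"

text \<open>A finite natural basis \<open>e 1, \<dots>, e n\<close>; values of \<open>e\<close> outside \<open>{1..n}\<close> are irrelevant.
  Its existence makes the algebra an \<open>n\<close>-dimensional evolution algebra.\<close>

definition natural_basis :: "nat \<Rightarrow> (nat \<Rightarrow> 'e) \<Rightarrow> bool" where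
  "natural_basis n e \<longleftrightarrow>
    inj_on e {1..n} \<and> independent (e ` {1..n}) \<and> span (e ` {1..n}) = UNIV \<and>
    (\<forall>i\<in>{1..n}. \<forall>j\<in>{1..n}. i \<noteq> j \<longrightarrow> e i \<bullet> e j = 0)"

definition structural_constants :: "nat \<Rightarrow> (nat \<Rightarrow> 'e) \<Rightarrow> (nat \<Rightarrow> nat \<Rightarrow> 'k) \<Rightarrow> bool" where
  "structural_constants n e a \<longleftrightarrow> (\<forall>i\<in>{1..n}. e i \<bullet> e i = (\<Sum>k=1..n. a i k *s e k))"

end

end

theory Submission
  imports Defs
begin

text \<open>Give each basis vector a weight such that the weight at least doubles along every nonzero
  structural constant. Because distinct basis vectors annihilate each other, the only products
  that matter are squares, so the spans of the basis vectors of weight at least \<open>t\<close> form a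
  multiplicative filtration. Hence \<open>E\<^sup>k\<close> lies in weight at least \<open>k\<close> and vanishes as soon as
  \<open>k\<close> exceeds all weights (lemma \<open>alg_power_eq_0_if_weights\<close>).

  Conversely, consider a chain of basis vectors in which each square involves only later members of
  the chain, and involves the immediate successor. Squaring a combination of members that starts at
  one of them gives a combination that starts at the next one. So \<open>r - 1\<close> successive squarings of
  the first of \<open>r\<close> members end at a nonzero multiple of the last member, which lies in
  \<open>E\<close> to the power \<open>2\<^sup>r\<^sup>-\<^sup>1\<close> (lemma \<open>alg_power_ne_0_if_chain\<close>).

  The hypotheses of the theorem split the basis into two such chains, of lengths \<open>s\<close> and
  \<open>n - s + 1\<close>, which have only their last member \<open>e n\<close> in common and do not interact otherwise.
  The longer chain gives the lower bound. For the upper bound, the weight of a vector before the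
  end of its chain is \<open>2\<close> to the number of its predecessors, and the weight of \<open>e n\<close> is the
  larger of the values that the two chains prescribe for it, \<open>2\<close> to the
  \<open>max (s - 1) (n - s)\<close>.\<close>

section \<open>Bilinearity of the product\<close>

context nonassoc_algebra
begin

lemma mult_add_right: "x \<bullet> (y + z) = x \<bullet> y + x \<bullet> z"
  using module_hom.add[OF linear_mult_right[of x, unfolded linear_iff_module_hom]] .

lemma mult_add_left: "(x + y) \<bullet> z = x \<bullet> z + y \<bullet> z"
  using module_hom.add[OF linear_mult_left[of z, unfolded linear_iff_module_hom]] .

lemma mult_scale_right: "x \<bullet> (c *s y) = c *s (x \<bullet> y)"
  using module_hom.scale[OF linear_mult_right[of x, unfolded linear_iff_module_hom]] .

lemma mult_scale_left: "(c *s x) \<bullet> y = c *s (x \<bullet> y)"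
  using module_hom.scale[OF linear_mult_left[of y, unfolded linear_iff_module_hom]] .

lemma mult_zero_right: "x \<bullet> 0 = 0"
  using module_hom.zero[OF linear_mult_right[of x, unfolded linear_iff_module_hom]] .

lemma mult_zero_left: "0 \<bullet> x = 0"
  using module_hom.zero[OF linear_mult_left[of x, unfolded linear_iff_module_hom]] .

lemma mult_in_subspace_if_generators:
  assumes "subspace T" and "x \<in> span A" and "y \<in> span B"
    and gen: "\<And>u v. u \<in> A \<Longrightarrow> v \<in> B \<Longrightarrow> u \<bullet> v \<in> T"
  shows "x \<bullet> y \<in> T"
proof -
  have gen_left: "u \<bullet> y \<in> T" if "u \<in> A" for u
    using \<open>y \<in> span B\<close>
  proof (induction rule: span_induct_alt)
    case base
    show ?case using \<open>subspace T\<close> by (simp add: mult_zero_right subspace_0)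
  next
    case (step c v z)
    then show ?case
      using gen[OF that] \<open>subspace T\<close>
      by (simp add: mult_add_right mult_scale_right subspace_add subspace_scale)
  qed
  show ?thesis
    using \<open>x \<in> span A\<close>
  proof (induction rule: span_induct_alt)
    case base
    show ?case using \<open>subspace T\<close> by (simp add: mult_zero_left subspace_0)
  next
    case (step c v z)
    then show ?case
      using gen_left \<open>subspace T\<close>
      by (simp add: mult_add_left mult_scale_left subspace_add subspace_scale)
  qed
qed


section \<open>Powers of an algebra\<close>

lemma alg_power_1: "alg_power 1 = UNIV"
  by (simp add: alg_power.simps)

lemma alg_power_ge_2:
  "2 \<le> k \<Longrightarrow>
    alg_power k = span (\<Union>i\<in>{1..<k}. subspace_prod (alg_power i) (alg_power (k - i)))"
  by (subst alg_power.simps) simp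

lemma subspace_alg_power: "subspace (alg_power k)"
  by (subst alg_power.simps) auto

lemma mult_in_alg_power:
  assumes "1 \<le> p" "1 \<le> q" "x \<in> alg_power p" "y \<in> alg_power q"
  shows "x \<bullet> y \<in> alg_power (p + q)"
proof -
  have "x \<bullet> y \<in> subspace_prod (alg_power p) (alg_power (p + q - p))"
    unfolding subspace_prod_def using assms by (intro span_base) auto
  moreover have "p \<in> {1..<p + q}" using assms by simp
  ultimately have "x \<bullet> y \<in> (\<Union>i\<in>{1..<p + q}. subspace_prod (alg_power i) (alg_power (p + q - i)))"
    by blast
  then show ?thesis
    using assms by (subst alg_power_ge_2) (auto intro: span_base)
qed

lemma alg_power_subset_if_products:
  assumes "2 \<le> k" and "subspace T"
    and "\<And>p q x y. 1 \<le> p \<Longrightarrow> 1 \<le> q \<Longrightarrow> p + q = k \<Longrightarrow> x \<in> alg_power p \<Longrightarrow> y \<in> alg_power q \<Longrightarrow>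
      x \<bullet> y \<in> T"
  shows "alg_power k \<subseteq> T"
proof -
  have "subspace_prod (alg_power p) (alg_power (k - p)) \<subseteq> T" if "p \<in> {1..<k}" for p
    unfolding subspace_prod_def
  proof (rule span_minimal[OF _ \<open>subspace T\<close>])
    show "{u \<bullet> v |u v. u \<in> alg_power p \<and> v \<in> alg_power (k - p)} \<subseteq> T"
      using assms(3)[of p "k - p"] that by auto
  qed
  then show ?thesis
    unfolding alg_power_ge_2[OF \<open>2 \<le> k\<close>] by (intro span_minimal assms(2)) blast
qed

text \<open>For \<open>k \<ge> 2\<close>, one of the two exponents of a summand \<open>E\<^sup>p E\<^sup>q\<close> with \<open>p + q = k + 1\<close> is at
  least \<open>2\<close>. By induction that exponent can be lowered by one.\<close>

lemma alg_power_Suc_subset: "1 \<le> k \<Longrightarrow> alg_power (Suc k) \<subseteq> alg_power k"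
proof (induction k rule: less_induct)
  case (less k)
  show ?case
  proof (cases "k = 1")
    case True
    then show ?thesis by (simp add: alg_power_1[simplified])
  next
    case False
    show ?thesis
    proof (rule alg_power_subset_if_products[OF _ subspace_alg_power])
      show "2 \<le> Suc k" using less.prems by simp
      fix p q x y
      assume pq: "1 \<le> p" "1 \<le> q" "p + q = Suc k" and xy: "x \<in> alg_power p" "y \<in> alg_power q"
      show "x \<bullet> y \<in> alg_power k"
      proof (cases "2 \<le> p")
        case True
        then have "x \<in> alg_power (p - 1)"
          using less.IH[of "p - 1"] pq xy by (auto simp: subset_iff)
        then show ?thesis
          using mult_in_alg_power[of "p - 1" q x y] True pq xy by simp
      next
        case p: False
        then have "y \<in> alg_power (q - 1)"
          using less.IH[of "q - 1"] less.prems pq xy False by (auto simp: subset_iff)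
        then show ?thesis
          using mult_in_alg_power[of p "q - 1" x y] p less.prems False pq xy by simp
      qed
    qed
  qed
qed

lemma alg_power_antimono: "1 \<le> m \<Longrightarrow> m \<le> k \<Longrightarrow> alg_power k \<subseteq> alg_power m"
proof (induction k)
  case (Suc k)
  then show ?case using alg_power_Suc_subset[of k] by (cases "m = Suc k") auto
qed simp

lemma is_nilpotent_index_Suc:
  assumes "1 \<le> k" and "alg_power k \<noteq> {0}" and "alg_power (Suc k) = {0}"
  shows "is_nilpotent_index (Suc k)"
  unfolding is_nilpotent_index_def
proof (intro conjI allI impI)
  fix m assume m: "1 \<le> m \<and> m < Suc k"
  show "alg_power m \<noteq> {0}"
    using alg_power_antimono[of m k] m assms(2) subspace_0[OF subspace_alg_power, of k] by auto
qed (use assms in auto)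


section \<open>Weights and chains in an evolution algebra\<close>

lemma basis_vector_square_in_span:
  assumes "structural_constants n e a" and "p \<in> {1..n}"
  shows "e p \<bullet> e p \<in> span {e q | q. q \<in> {1..n} \<and> a p q \<noteq> 0}"
proof -
  have "a p q *s e q \<in> span {e q | q. q \<in> {1..n} \<and> a p q \<noteq> 0}" if "q \<in> {1..n}" for q
    by (cases "a p q = 0") (use that in \<open>auto intro!: span_scale intro: span_base span_zero\<close>)
  then show ?thesis
    using assms by (auto simp: structural_constants_def intro!: span_sum)
qed

text \<open>The bound \<open>2 * w p \<le> w q\<close> is what makes \<open>F t = span {e p | t \<le> w p}\<close> a multiplicative
  filtration: a nonzero product of a generator of \<open>F u\<close> and a generator of \<open>F v\<close> is the square of
  one \<open>e p\<close> with \<open>max u v \<le> w p\<close>, and \<open>u + v \<le> 2 * max u v\<close>.\<close>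

lemma alg_power_eq_0_if_weights:
  fixes w :: "nat \<Rightarrow> nat"
  assumes basis: "natural_basis n e" and const: "structural_constants n e a"
    and w_pos: "\<And>p. p \<in> {1..n} \<Longrightarrow> 1 \<le> w p" and w_le: "\<And>p. p \<in> {1..n} \<Longrightarrow> w p \<le> N"
    and double: "\<And>p q. p \<in> {1..n} \<Longrightarrow> q \<in> {1..n} \<Longrightarrow> a p q \<noteq> 0 \<Longrightarrow> 2 * w p \<le> w q"
  shows "alg_power (Suc N) = {0}"
proof -
  define F where "F t = span {e p | p. p \<in> {1..n} \<and> t \<le> w p}" for t
  have F_mult: "x \<bullet> y \<in> F (u + v)" if "x \<in> F u" "y \<in> F v" for x y u v
  proof (rule mult_in_subspace_if_generators)
    show "x \<in> span {e p | p. p \<in> {1..n} \<and> u \<le> w p}" "y \<in> span {e p | p. p \<in> {1..n} \<and> v \<le> w p}"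
      using that by (simp_all add: F_def)
    show "subspace (F (u + v))" by (simp add: F_def)
    fix b c
    assume "b \<in> {e p | p. p \<in> {1..n} \<and> u \<le> w p}" "c \<in> {e p | p. p \<in> {1..n} \<and> v \<le> w p}"
    then obtain p q where p: "b = e p" "p \<in> {1..n}" "u \<le> w p"
      and q: "c = e q" "q \<in> {1..n}" "v \<le> w q" by auto
    show "b \<bullet> c \<in> F (u + v)"
    proof (cases "p = q")
      case True
      have "{e r | r. r \<in> {1..n} \<and> a p r \<noteq> 0} \<subseteq> {e r | r. r \<in> {1..n} \<and> u + v \<le> w r}"
        using double[of p] p q True by fastforce
      then have "e p \<bullet> e p \<in> F (u + v)"
        unfolding F_def using basis_vector_square_in_span[OF const p(2)] span_mono by blast
      then show ?thesis using p q True by simp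
    next
      case False
      then have "b \<bullet> c = 0" using basis p q by (auto simp: natural_basis_def)
      then show ?thesis by (simp add: F_def span_zero)
    qed
  qed
  have "alg_power k \<subseteq> F k" if "1 \<le> k" for k
    using that
  proof (induction k rule: less_induct)
    case (less k)
    show ?case
    proof (cases "k = 1")
      case True
      have "{e p | p. p \<in> {1..n} \<and> 1 \<le> w p} = e ` {1..n}" using w_pos by blast
      then have "F 1 = UNIV" using basis by (simp add: F_def natural_basis_def)
      then show ?thesis using True by simp
    next
      case False
      show ?thesis
      proof (rule alg_power_subset_if_products)
        show "2 \<le> k" using False less.prems by simp
        show "subspace (F k)" by (simp add: F_def)
        fix p q x y
        assume "1 \<le> p" "1 \<le> q" "p + q = k" "x \<in> alg_power p" "y \<in> alg_power q"
        then show "x \<bullet> y \<in> F k"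
          using F_mult[of x p y q] less.IH[of p] less.IH[of q] by auto
      qed
    qed
  qed
  moreover have "F (Suc N) = {0}"
  proof -
    have "{e p | p. p \<in> {1..n} \<and> Suc N \<le> w p} = {}" using w_le by fastforce
    then show ?thesis unfolding F_def by (simp only: span_empty)
  qed
  ultimately show ?thesis
    using subspace_0[OF subspace_alg_power, of "Suc N"] by fastforce
qed

text \<open>After \<open>l\<close> squarings of \<open>e (c 1)\<close> the result has the form \<open>b *s e (c (l + 1)) + y\<close>
  with \<open>b \<noteq> 0\<close> and \<open>y\<close> supported on later members of the chain. The mixed products vanish, so its
  square is \<open>b\<^sup>2 *s (e (c (l + 1)) \<bullet> e (c (l + 1))) + y \<bullet> y\<close>; only the first summand
  contributes to \<open>e (c (l + 2))\<close>, and it does so with a nonzero coefficient.\<close>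

lemma alg_power_ne_0_if_chain:
  fixes c :: "nat \<Rightarrow> nat"
  assumes basis: "natural_basis n e" and const: "structural_constants n e a"
    and "1 \<le> r" and c_mono: "strict_mono_on {1..r} c" and c_range: "c ` {1..r} \<subseteq> {1..n}"
    and succ: "\<And>l. 1 \<le> l \<Longrightarrow> l < r \<Longrightarrow> a (c l) (c (l + 1)) \<noteq> 0"
    and later: "\<And>l q. l \<in> {1..r} \<Longrightarrow> q \<in> {1..n} \<Longrightarrow> a (c l) q \<noteq> 0 \<Longrightarrow> q \<in> c ` {l<..r}"
  shows "alg_power (2 ^ (r - 1)) \<noteq> {0}"
proof -
  define T where "T l = span (e ` c ` {l<..r})" for l
  have T_mono: "T m \<subseteq> T l" if "l \<le> m" for l m
    unfolding T_def using that by (intro span_mono image_mono) auto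
  have orth: "e (c l) \<bullet> e (c m) = 0" if "l \<in> {1..r}" "m \<in> {1..r}" "l \<noteq> m" for l m
  proof -
    have "c l \<noteq> c m" using that strict_mono_on_imp_inj_on[OF c_mono] by (auto dest: inj_onD)
    moreover have "c l \<in> {1..n}" "c m \<in> {1..n}" using that c_range by blast+
    ultimately show ?thesis using basis by (auto simp: natural_basis_def)
  qed
  have square: "e (c l) \<bullet> e (c l) \<in> T l" if "l \<in> {1..r}" for l
  proof -
    have "{e q | q. q \<in> {1..n} \<and> a (c l) q \<noteq> 0} \<subseteq> e ` c ` {l<..r}"
      using later[OF that] by blast
    then show ?thesis
      unfolding T_def
      using basis_vector_square_in_span[OF const, of "c l"] c_range that span_mono by blast
  qed
  have leading: "\<exists>y\<in>T (l + 1). e (c l) \<bullet> e (c l) = a (c l) (c (l + 1)) *s e (c (l + 1)) + y"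
    if l: "1 \<le> l" "l < r" for l
  proof
    let ?y = "\<Sum>q\<in>{1..n} - {c (l + 1)}. a (c l) q *s e q"
    have "l \<in> {1..r}" "l + 1 \<in> {1..r}" using l by auto
    then have "c (l + 1) \<in> {1..n}" "c l \<in> {1..n}" using c_range by blast+
    then show "e (c l) \<bullet> e (c l) = a (c l) (c (l + 1)) *s e (c (l + 1)) + ?y"
      using const sum.remove[of "{1..n}" "c (l + 1)" "\<lambda>q. a (c l) q *s e q"]
      by (simp add: structural_constants_def)
    have "a (c l) q *s e q \<in> T (l + 1)" if q: "q \<in> {1..n} - {c (l + 1)}" for q
    proof (cases "a (c l) q = 0")
      case True
      then show ?thesis by (simp add: T_def span_zero)
    next
      case False
      then obtain m where m: "m \<in> {l<..r}" "q = c m" using later[of l q] q l by auto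
      then have "m \<noteq> l + 1" using q by auto
      then have "m \<in> {l + 1<..r}" using m by auto
      then show ?thesis unfolding T_def using m by (intro span_scale span_base) blast
    qed
    then show "?y \<in> T (l + 1)" unfolding T_def by (intro span_sum) auto
  qed
  have "\<exists>b y. b \<noteq> 0 \<and> y \<in> T (l + 1) \<and> b *s e (c (l + 1)) + y \<in> alg_power (2 ^ l)"
    if "l < r" for l
    using that
  proof (induction l)
    case 0
    have "1 *s e (c (0 + 1)) + 0 \<in> alg_power (2 ^ 0)" by (simp add: alg_power_1[simplified])
    moreover have "0 \<in> T (0 + 1)" by (simp add: T_def span_zero)
    ultimately show ?case using zero_neq_one by metis
  next
    case (Suc l)
    then obtain b y where b: "b \<noteq> 0" and y: "y \<in> T (l + 1)"
      and x: "b *s e (c (l + 1)) + y \<in> alg_power (2 ^ l)" by auto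
    let ?u = "e (c (l + 1))" and ?d = "a (c (l + 1)) (c (l + 2))"
    obtain z where z: "z \<in> T (l + 2)" "?u \<bullet> ?u = ?d *s e (c (l + 2)) + z"
      using leading[of "l + 1"] Suc.prems by auto
    have uy: "?u \<bullet> y = 0"
    proof -
      have "?u \<bullet> y \<in> {0}"
      proof (rule mult_in_subspace_if_generators[OF _ _ y[unfolded T_def]])
        show "?u \<in> span {?u}" by (simp add: span_base)
        show "u \<bullet> v \<in> {0}" if "u \<in> {?u}" "v \<in> e ` c ` {l + 1<..r}" for u v
          using that orth[of "l + 1"] Suc.prems by auto
      qed simp
      then show ?thesis by simp
    qed
    have yu: "y \<bullet> ?u = 0"
    proof -
      have "y \<bullet> ?u \<in> {0}"
      proof (rule mult_in_subspace_if_generators[OF _ y[unfolded T_def]])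
        show "?u \<in> span {?u}" by (simp add: span_base)
        show "v \<bullet> u \<in> {0}" if "v \<in> e ` c ` {l + 1<..r}" "u \<in> {?u}" for u v
          using that orth[of _ "l + 1"] Suc.prems by auto
      qed simp
      then show ?thesis by simp
    qed
    have yy: "y \<bullet> y \<in> T (l + 2)"
    proof (rule mult_in_subspace_if_generators)
      show "subspace (T (l + 2))" by (simp add: T_def)
      show "y \<in> span (e ` c ` {l + 1<..r})" "y \<in> span (e ` c ` {l + 1<..r})"
        using y by (simp_all add: T_def)
      fix u v assume "u \<in> e ` c ` {l + 1<..r}" "v \<in> e ` c ` {l + 1<..r}"
      then obtain p q where p: "u = e (c p)" "p \<in> {l + 1<..r}" and q: "v = e (c q)" "q \<in> {l + 1<..r}"
        by blast
      show "u \<bullet> v \<in> T (l + 2)"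
      proof (cases "p = q")
        case True
        then show ?thesis using square[of p] T_mono[of "l + 2" p] p q by auto
      next
        case False
        then show ?thesis using orth[of p q] p q by (simp add: T_def span_zero)
      qed
    qed
    have "(b *s ?u + y) \<bullet> (b *s ?u + y) = (b * b * ?d) *s e (c (l + 2)) + ((b * b) *s z + y \<bullet> y)"
      by (simp only: mult_add_left mult_add_right mult_scale_left mult_scale_right uy yu z(2)
          scale_zero_right add_0_left add_0_right scale_right_distrib scale_scale add.assoc mult.assoc)
    moreover have "(b *s ?u + y) \<bullet> (b *s ?u + y) \<in> alg_power (2 ^ Suc l)"
      using mult_in_alg_power[OF _ _ x x] by (simp add: mult_2)
    moreover have "(b * b) *s z + y \<bullet> y \<in> T (l + 2)"
      using z(1) yy unfolding T_def by (intro span_add span_scale)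
    moreover have "b * b * ?d \<noteq> 0" using b succ[of "l + 1"] Suc.prems by simp
    ultimately show ?case by (metis add_2_eq_Suc' Suc_eq_plus1)
  qed
  from this[of "r - 1"] obtain b y where "b \<noteq> 0" "y \<in> T r"
    and mem: "b *s e (c r) + y \<in> alg_power (2 ^ (r - 1))"
    using \<open>1 \<le> r\<close> by auto
  moreover have "e (c r) \<noteq> 0"
  proof -
    have "c r \<in> {1..n}" using c_range \<open>1 \<le> r\<close> by (auto simp: image_subset_iff)
    then show ?thesis using basis dependent_zero[of "e ` {1..n}"] by (force simp: natural_basis_def)
  qed
  moreover have "T r = {0}" by (simp add: T_def)
  ultimately show ?thesis by auto
qed

end


section \<open>Two chains with a common last member\<close>

theorem proposition3p13:
  fixes scale :: "'k::field \<Rightarrow> 'e::ab_group_add \<Rightarrow> 'e"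
    and mult :: "'e \<Rightarrow> 'e \<Rightarrow> 'e"
    and n s :: nat
    and e :: "nat \<Rightarrow> 'e"
    and a :: "nat \<Rightarrow> nat \<Rightarrow> 'k"
    and i j :: "nat \<Rightarrow> nat"
  assumes "nonassoc_algebra scale mult"
    and "nonassoc_algebra.natural_basis scale mult n e"
    and "nonassoc_algebra.structural_constants scale mult n e a"
    and upper: "\<And>p q. p \<in> {1..n} \<Longrightarrow> q \<in> {1..n} \<Longrightarrow> q \<le> p \<Longrightarrow> a p q = 0"
    and "1 \<le> s" and "s < n - 1"
    and i_range: "\<And>k. k \<in> {1..s - 1} \<Longrightarrow> 1 \<le> i k \<and> i k \<le> n - 2"
    and i_mono: "strict_mono_on {1..s - 1} i"
    and i_last: "i s = n"
    and cond_i: "\<And>k q. k \<in> {1..s - 1} \<Longrightarrow> q \<in> {1..n} - (i ` {1..s - 1} \<union> {n}) \<Longrightarrow>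
                   a q (i k) = 0 \<and> a (i k) q = 0"
    and cond_ii: "\<And>k. k \<in> {1..s - 1} \<Longrightarrow> a (i k) (i (k + 1)) = 1"
    and j_mono: "strict_mono_on {1..n - s + 1} j"
    and j_image: "j ` {1..n - s + 1} = {1..n} - i ` {1..s - 1}"
    and j_last: "j (n - s + 1) = n"
    and cond_iii: "\<And>l. l \<in> {1..n - s} \<Longrightarrow> a (j l) (j (l + 1)) = 1"
  shows "nonassoc_algebra.is_nilpotent_index scale mult (2 ^ max (s - 1) (n - s) + 1)"
proof -
  interpret nonassoc_algebra scale mult by fact
  have basis: "natural_basis n e" and const: "structural_constants n e a" by fact+
  define M where "M = max (s - 1) (n - s)"
  let ?I = "i ` {1..s - 1}"
  have i_inj: "inj_on i {1..s - 1}" and j_inj: "inj_on j {1..n - s + 1}"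
    using i_mono j_mono by (auto intro: strict_mono_on_imp_inj_on)
  have n_notin: "n \<notin> ?I" using i_range \<open>s < n - 1\<close> by fastforce
  have n_row: "a n q = 0" if "q \<in> {1..n}" for q
    using upper[of n q] that by auto
  have j_cases: "\<exists>l\<in>{1..n - s}. p = j l" if "p \<in> {1..n}" "p \<notin> ?I" "p \<noteq> n" for p
  proof -
    have "p \<in> j ` {1..n - s + 1}" using that unfolding j_image by simp
    then obtain l where "l \<in> {1..n - s + 1}" "p = j l" by blast
    then show ?thesis using that j_last by (cases "l = n - s + 1") auto
  qed
  have j_in: "j l \<in> {1..n}" "j l \<notin> ?I" "j l \<noteq> n" if "l \<in> {1..n - s}" for l
  proof -
    have l: "l \<in> {1..n - s + 1}" using that by auto
    then have "j l \<in> {1..n} - ?I" unfolding j_image[symmetric] by (rule imageI)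
    then show "j l \<in> {1..n}" "j l \<notin> ?I" by auto
    show "j l \<noteq> n"
      using inj_onD[OF j_inj, of l "n - s + 1"] l that j_last by auto
  qed
  have i_in: "i k \<in> {1..n}" if "k \<in> {1..s - 1}" for k
    using i_range[OF that] by auto

  \<comment> \<open>Appending \<open>i s = n\<close> to the \<open>i\<close>-indices keeps them increasing.\<close>
  have i_mono': "strict_mono_on {1..s} i"
  proof (rule strict_mono_onI)
    fix k m assume km: "k \<in> {1..s}" "m \<in> {1..s}" "k < m"
    show "i k < i m"
    proof (cases "m = s")
      case True
      then show ?thesis using i_range[of k] km i_last \<open>s < n - 1\<close> by fastforce
    next
      case False
      then show ?thesis using strict_mono_onD[OF i_mono, of k m] km by auto
    qed
  qed
  have i_later: "q \<in> i ` {k<..s}" if k: "k \<in> {1..s}" and q: "q \<in> {1..n}" and ne: "a (i k) q \<noteq> 0" for k q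
  proof -
    have "k \<noteq> s" using n_row[OF q] ne i_last by auto
    then have k': "k \<in> {1..s - 1}" using k by auto
    then have "q \<in> ?I \<union> {n}" using cond_i[of k q] q ne by auto
    then obtain m where m: "m \<in> {1..s}" "q = i m" using i_last \<open>1 \<le> s\<close> by fastforce
    have "i k < i m" using upper[OF i_in[OF k'] q] ne m by force
    then have "k < m" using strict_mono_on_less[OF i_mono' k m(1)] by simp
    then show ?thesis using m by auto
  qed
  have j_later: "q \<in> j ` {l<..n - s + 1}"
    if l: "l \<in> {1..n - s + 1}" and q: "q \<in> {1..n}" and ne: "a (j l) q \<noteq> 0" for l q
  proof -
    have "l \<noteq> n - s + 1" using n_row[OF q] ne j_last by auto
    then have l': "l \<in> {1..n - s}" using l by auto
    have "q \<notin> ?I" using cond_i[of _ "j l"] j_in[OF l'] ne by auto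
    then have "q \<in> j ` {1..n - s + 1}" using q unfolding j_image by simp
    then obtain m where m: "m \<in> {1..n - s + 1}" "q = j m" by blast
    have "j l < j m" using upper[OF j_in(1)[OF l'] q] ne m by force
    then have "l < m" using strict_mono_on_less[OF j_mono l m(1)] by simp
    then show ?thesis using m by auto
  qed

  have "alg_power (2 ^ (s - 1)) \<noteq> {0}"
  proof (rule alg_power_ne_0_if_chain[OF basis const \<open>1 \<le> s\<close> i_mono' _ _ i_later])
    show "i ` {1..s} \<subseteq> {1..n}"
    proof
      fix q assume "q \<in> i ` {1..s}"
      then obtain k where k: "k \<in> {1..s}" "q = i k" by blast
      then show "q \<in> {1..n}"
        using i_in[of k] i_last \<open>s < n - 1\<close> by (cases "k = s") auto
    qed
    show "a (i k) (i (k + 1)) \<noteq> 0" if "1 \<le> k" "k < s" for k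
      using cond_ii[of k] that by auto
  qed
  moreover have "alg_power (2 ^ (n - s + 1 - 1)) \<noteq> {0}"
  proof (rule alg_power_ne_0_if_chain[OF basis const _ j_mono _ _ j_later])
    show "j ` {1..n - s + 1} \<subseteq> {1..n}" using j_image by auto
    show "a (j l) (j (l + 1)) \<noteq> 0" if "1 \<le> l" "l < n - s + 1" for l
      using cond_iii[of l] that by auto
  qed auto
  ultimately have lower: "alg_power (2 ^ M) \<noteq> {0}" by (auto simp: M_def max_def)

  \<comment> \<open>The positions in a chain start at \<open>1\<close>, so \<open>p\<close> has one predecessor less than its position.\<close>
  define w :: "nat \<Rightarrow> nat" where
    "w p = (if p = n then 2 ^ M
      else if p \<in> ?I then 2 ^ (the_inv_into {1..s - 1} i p - 1)
      else 2 ^ (the_inv_into {1..n - s + 1} j p - 1))" for p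
  have w_n: "w n = 2 ^ M" by (simp add: w_def)
  have w_i: "w (i k) = 2 ^ (k - 1)" if "k \<in> {1..s - 1}" for k
  proof -
    have "i k \<in> ?I" using that by blast
    moreover from this have "i k \<noteq> n" using n_notin by metis
    ultimately show ?thesis by (simp only: w_def the_inv_into_f_f[OF i_inj that] if_True if_False)
  qed
  have w_j: "w (j l) = 2 ^ (l - 1)" if "l \<in> {1..n - s}" for l
    using j_in[OF that] the_inv_into_f_f[OF j_inj, of l] that by (simp add: w_def)
  have w_cases: "p = n \<or> (\<exists>k\<in>{1..s - 1}. p = i k) \<or> (\<exists>l\<in>{1..n - s}. p = j l)"
    if "p \<in> {1..n}" for p
    using that j_cases[of p] by blast
  have double_power: "2 * 2 ^ (k - 1) = (2 :: nat) ^ k" if "1 \<le> k" for k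
    using that by (cases k) auto
  have "alg_power (Suc (2 ^ M)) = {0}"
  proof (rule alg_power_eq_0_if_weights[OF basis const])
    fix p assume p: "p \<in> {1..n}"
    show "1 \<le> w p" by (simp add: w_def)
    show "w p \<le> 2 ^ M"
      using w_cases[OF p] w_n w_i w_j by (auto simp: M_def intro!: power_increasing)
  next
    fix p q assume p: "p \<in> {1..n}" and q: "q \<in> {1..n}" and ne: "a p q \<noteq> 0"
    consider "p = n" | k where "k \<in> {1..s - 1}" "p = i k" | l where "l \<in> {1..n - s}" "p = j l"
      using w_cases[OF p] by blast
    then show "2 * w p \<le> w q"
    proof cases
      case 1
      then show ?thesis using n_row[OF q] ne by simp
    next
      case 2
      have "q \<in> i ` {k<..s}" by (rule i_later[OF _ q]) (use 2 ne in auto)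
      then obtain m where m: "k < m" "m \<le> s" "q = i m" by fastforce
      have "w q \<ge> 2 ^ k"
      proof (cases "m = s")
        case True
        then show ?thesis using m 2 i_last w_n by (auto simp: M_def intro!: power_increasing)
      next
        case False
        then show ?thesis using m 2 w_i[of m] by (auto intro!: power_increasing)
      qed
      then show ?thesis using 2 w_i[of k] double_power[of k] by simp
    next
      case 3
      have "q \<in> j ` {l<..n - s + 1}" by (rule j_later[OF _ q]) (use 3 ne in auto)
      then obtain m where m: "l < m" "m \<le> n - s + 1" "q = j m" by fastforce
      have "w q \<ge> 2 ^ l"
      proof (cases "m = n - s + 1")
        case True
        then show ?thesis using m 3 j_last w_n by (auto simp: M_def intro!: power_increasing)
      next
        case False
        then show ?thesis using m 3 w_j[of m] by (auto intro!: power_increasing)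
      qed
      then show ?thesis using 3 w_j[of l] double_power[of l] by simp
    qed
  qed
  then have "is_nilpotent_index (Suc (2 ^ M))"
    using lower by (intro is_nilpotent_index_Suc) auto
  then show ?thesis by (simp add: M_def)
qed

end
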